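(* Let $F$ be the face $(\hat U_{3,5}^{1},U_{2,3}^{123})$ of $\Gamma_4$. For real $a,b\ge 0$, the point $\mathbf h=(a,b)\in F$ is entropic if and only if $a=\log v_1$ and $b=\log v_2$ for some positive integers $v_1,v_2$.
   Context: $N_4=\{1,2,3,4\}$. $\Gamma_4$ is the cone of all polymatroid rank functions on $N_4$. A set function $\mathbf h:2^{N_4}\to\mathbb R$ is called entropic if there is a random vector $(X_1,X_2,X_3,X_4)$, each $X_i$ taking values in a finite set, with $\mathbf h(A)=H(X_A)$ for all $A\subseteq N_4$, where $H$ is Shannon entropy, $X_A=(X_j,j\in A)$ and $\mathbf h(\emptyset)=0$. Logarithms (also in the entropy) are to base $2$. For two (poly)matroids $M_1,M_2$ on $N_4$ with rank functions $\mathbf r_1,\mathbf r_2$, $(M_1,M_2)$ denotes the face $\{a\mathbf r_1+b\mathbf r_2:a,b\ge0\}$ of $\Gamma_4$, and $(a,b)$ denotes the point $a\mathbf r_1+b\mathbf r_2$. $\hat U^1_{3,5}$ is the integer polymatroid on $N_4$ with rank function $\mathbf r(A)=\min\{3,|A|+1\}$ if $1\in A$ and $\mathbf r(A)=|A|$ if $1\notin A$. $U^{123}_{2,3}$ is the matroid on $N_4$ with $\mathbf r(A)=\min\{2,|A\cap\{1,2,3\}|\}$. *)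

theory Defs
  imports "HOL-Probability.Probability"
begin

text \<open>
  The ground set \<open>N\<^sub>4\<close> is the numeral type \<^typ>\<open>4\<close>, whose elements are \<open>1\<close>, \<open>2\<close>, \<open>3\<close> and
  \<open>4\<close> (arithmetic is modulo 4, so \<open>4 = 0\<close>). Set functions on \<open>N\<^sub>4\<close> form the Euclidean space
  \<open>real ^ (4 set)\<close>.
\<close>

type_synonym set_function = "real ^ (4 set)"

text \<open>
  The polymatroid axioms; nonnegativity follows from the value at \<open>{}\<close> and monotonicity.
\<close>

definition Gamma4 :: "set_function set" where
  "Gamma4 = {h. h $ {} = 0 \<and> (\<forall>A B. A \<subseteq> B \<longrightarrow> h $ A \<le> h $ B) \<and>
     (\<forall>A B. h $ (A \<union> B) + h $ (A \<inter> B) \<le> h $ A + h $ B)}"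

definition U_hat_3_5_1 :: set_function where
  "U_hat_3_5_1 = (\<chi> A. if 1 \<in> A then min 3 (real (card A) + 1) else real (card A))"

definition U_2_3_123 :: set_function where
  "U_2_3_123 = (\<chi> A. min 2 (real (card (A \<inter> {1, 2, 3}))))"

definition face_point :: "set_function \<Rightarrow> set_function \<Rightarrow> real \<Rightarrow> real \<Rightarrow> set_function" where
  "face_point r1 r2 a b = a *\<^sub>R r1 + b *\<^sub>R r2"

definition spanned_face :: "set_function \<Rightarrow> set_function \<Rightarrow> set_function set" where
  "spanned_face r1 r2 = {face_point r1 r2 a b | a b. 0 \<le> a \<and> 0 \<le> b}"

definition subvector :: "(4 \<Rightarrow> 'a \<Rightarrow> 'b) \<Rightarrow> 4 set \<Rightarrow> 'a \<Rightarrow> (4 \<Rightarrow> 'b)" where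
  "subvector X A = (\<lambda>\<omega>. restrict (\<lambda>i. X i \<omega>) A)"

definition entropy_function :: "'a measure \<Rightarrow> (4 \<Rightarrow> 'a \<Rightarrow> 'b) \<Rightarrow> set_function" where
  "entropy_function M X =
     (\<chi> A. prob_space.entropy M 2 (count_space (subvector X A ` space M)) (subvector X A))"

text \<open>
  A definition cannot quantify over the type of the sample space and of the values, so these types
  are fixed to be \<^typ>\<open>4 \<Rightarrow> nat\<close> and \<^typ>\<open>nat\<close>; lemma \<open>entropicI\<close> below shows that this is no
  restriction. A \<^const>\<open>simple_function\<close> is a measurable map with finitely many values.
\<close>

definition entropic :: "set_function \<Rightarrow> bool" where
  "entropic h \<longleftrightarrow> (\<exists>(M :: (4 \<Rightarrow> nat) measure) (X :: 4 \<Rightarrow> (4 \<Rightarrow> nat) \<Rightarrow> nat).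
     prob_space M \<and> (\<forall>i. simple_function M (X i)) \<and> h = entropy_function M X)"

lemma simple_function_subvector:
  assumes "\<And>i. simple_function M (X i)"
  shows "simple_function M (subvector X A)"
proof -
  have "simple_function M (\<lambda>\<omega>. (X 1 \<omega>, X 2 \<omega>, X 3 \<omega>, X 4 \<omega>))"
    by (intro simple_function_Pair assms)
  then have "simple_function M ((\<lambda>(a, b, c, d). restrict (\<lambda>i::4. if i = 1 then a else
      if i = 2 then b else if i = 3 then c else d) A) \<circ> (\<lambda>\<omega>. (X 1 \<omega>, X 2 \<omega>, X 3 \<omega>, X 4 \<omega>)))"
    by (rule simple_function_compose)
  moreover have "(\<lambda>(a, b, c, d). restrict (\<lambda>i::4. if i = 1 then a else
      if i = 2 then b else if i = 3 then c else d) A) \<circ> (\<lambda>\<omega>. (X 1 \<omega>, X 2 \<omega>, X 3 \<omega>, X 4 \<omega>)) =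
      subvector X A"
  proof (rule ext)
    fix \<omega>
    show "((\<lambda>(a, b, c, d). restrict (\<lambda>i::4. if i = 1 then a else
      if i = 2 then b else if i = 3 then c else d) A) \<circ> (\<lambda>\<omega>. (X 1 \<omega>, X 2 \<omega>, X 3 \<omega>, X 4 \<omega>))) \<omega> =
      subvector X A \<omega>"
      unfolding subvector_def comp_def prod.case
      by (rule restrict_ext) (metis exhaust_4)
  qed
  ultimately show ?thesis by simp
qed

lemma entropicI:
  fixes M :: "'a measure" and X :: "4 \<Rightarrow> 'a \<Rightarrow> 'b"
  assumes M: "prob_space M" and X: "\<And>i. simple_function M (X i)"
  shows "entropic (entropy_function M X)"
proof -
  interpret information_space M 2
    using M by (simp add: information_space_def information_space_axioms_def)
  define R where "R = (\<Union>i. X i ` space M)"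
  have "finite R"
    unfolding R_def using X by (auto dest: simple_functionD)
  then obtain f :: "'b \<Rightarrow> nat" where f: "inj_on f R"
    using finite_imp_inj_to_nat_seg by blast
  define Y where "Y = (\<lambda>i \<omega>. f (X i \<omega>))"
  have Y: "simple_function M (Y i)" for i
    using simple_function_compose[OF X, of f i] by (simp add: Y_def comp_def)
  define Z where "Z = subvector Y UNIV"
  have Z: "simple_function M Z"
    unfolding Z_def by (rule simple_function_subvector[OF Y])
  define N where "N = distr M (count_space (Z ` space M)) Z"
  have Z_meas: "Z \<in> M \<rightarrow>\<^sub>M count_space (Z ` space M)"
    using measurable_simple_function[OF Z] by (auto simp: measurable_def)
  have N: "prob_space N"
    unfolding N_def by (rule prob_space_distr[OF Z_meas])
  have space_N: "space N = Z ` space M" and sets_N: "sets N = Pow (Z ` space M)"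
    by (simp_all add: N_def)
  have fin_Z: "finite (Z ` space M)"
    using Z by (rule simple_functionD)
  have sf_N: "simple_function N (V :: (4 \<Rightarrow> nat) \<Rightarrow> 'c)" for V
    using fin_Z by (auto simp: simple_function_def space_N sets_N)
  let ?P = "\<lambda>(i :: 4) (y :: 4 \<Rightarrow> nat). y i"
  have "entropy_function N ?P $ A = entropy_function M X $ A" for A
  proof -
    define V where "V = subvector ?P A"
    let ?S = "count_space (V ` space N)"
    have V: "V \<in> count_space (Z ` space M) \<rightarrow>\<^sub>M ?S"
      by (auto simp: space_N)
    have VZ: "V \<circ> Z = subvector Y A"
      by (auto simp: fun_eq_iff V_def Z_def subvector_def)
    have YX: "subvector Y A = (\<lambda>x. restrict (\<lambda>i. f (x i)) A) \<circ> subvector X A"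
      by (auto simp: fun_eq_iff Y_def subvector_def)
    have img: "V ` space N = subvector Y A ` space M"
      by (simp add: space_N VZ[symmetric] image_comp)
    have inj: "inj_on (\<lambda>x. restrict (\<lambda>i. f (x i)) A) (subvector X A ` space M)"
    proof (intro inj_onI)
      fix x y
      assume "x \<in> subvector X A ` space M" "y \<in> subvector X A ` space M"
        and eq: "restrict (\<lambda>i. f (x i)) A = restrict (\<lambda>i. f (y i)) A"
      then obtain \<omega> \<omega>' where \<omega>: "\<omega> \<in> space M" "x = subvector X A \<omega>"
          "\<omega>' \<in> space M" "y = subvector X A \<omega>'"
        by auto
      have "X i \<omega> = X i \<omega>'" if "i \<in> A" for i
      proof -
        have "f (X i \<omega>) = f (X i \<omega>')"
          using fun_cong[OF eq, of i] that \<omega> by (simp add: subvector_def)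
        moreover have "X i \<omega> \<in> R" "X i \<omega>' \<in> R"
          using \<omega> by (auto simp: R_def)
        ultimately show ?thesis
          using f by (auto dest: inj_onD)
      qed
      then show "x = y"
        using \<omega> by (auto simp: subvector_def fun_eq_iff)
    qed
    have "prob_space.entropy N 2 ?S V = - KL_divergence 2 ?S (distr N ?S V)"
      by (rule prob_space.entropy_def[OF N])
    also have "distr N ?S V = distr M ?S (V \<circ> Z)"
      unfolding N_def by (subst distr_distr) (use V Z_meas in \<open>auto simp: N_def\<close>)
    also have "- KL_divergence 2 ?S (distr M ?S (V \<circ> Z)) = entropy 2 (count_space (subvector Y A ` space M)) (subvector Y A)"
      unfolding img VZ by (rule prob_space.entropy_def[OF M, symmetric])
    also have "\<dots> = entropy 2 (count_space (subvector X A ` space M)) (subvector X A)"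
      unfolding YX by (rule entropy_of_inj[OF simple_function_subvector[OF X] inj])
    finally show ?thesis
      by (simp add: entropy_function_def V_def)
  qed
  then have "entropy_function M X = entropy_function N ?P"
    by (simp add: vec_eq_iff)
  with N sf_N show ?thesis
    unfolding entropic_def by blast
qed

lemma all_4_set:
  "(\<forall>A :: 4 set. P A) \<longleftrightarrow>
     P {} \<and> P {1} \<and> P {2} \<and> P {3} \<and> P {4} \<and> P {1, 2} \<and> P {1, 3} \<and> P {1, 4} \<and> P {2, 3} \<and>
     P {2, 4} \<and> P {3, 4} \<and> P {1, 2, 3} \<and> P {1, 2, 4} \<and> P {1, 3, 4} \<and> P {2, 3, 4} \<and>
     P {1, 2, 3, 4}"
proof -
  have "(\<forall>A :: 4 set. P A) \<longleftrightarrow> (\<forall>A \<in> Pow {1, 2, 3, 4}. P A)"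
    using UNIV_4 by auto
  then show ?thesis
    by (auto simp: Pow_insert)
qed

lemma ranks_values:
  "U_hat_3_5_1 $ {} = 0"
  "U_hat_3_5_1 $ {1} = 2" "U_hat_3_5_1 $ {2} = 1" "U_hat_3_5_1 $ {3} = 1" "U_hat_3_5_1 $ {4} = 1"
  "U_hat_3_5_1 $ {1, 2} = 3" "U_hat_3_5_1 $ {1, 3} = 3" "U_hat_3_5_1 $ {1, 4} = 3"
  "U_hat_3_5_1 $ {2, 3} = 2" "U_hat_3_5_1 $ {2, 4} = 2" "U_hat_3_5_1 $ {3, 4} = 2"
  "U_hat_3_5_1 $ {1, 2, 3} = 3" "U_hat_3_5_1 $ {1, 2, 4} = 3" "U_hat_3_5_1 $ {1, 3, 4} = 3"
  "U_hat_3_5_1 $ {2, 3, 4} = 3" "U_hat_3_5_1 $ {1, 2, 3, 4} = 3"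
  "U_2_3_123 $ {} = 0"
  "U_2_3_123 $ {1} = 1" "U_2_3_123 $ {2} = 1" "U_2_3_123 $ {3} = 1" "U_2_3_123 $ {4} = 0"
  "U_2_3_123 $ {1, 2} = 2" "U_2_3_123 $ {1, 3} = 2" "U_2_3_123 $ {1, 4} = 1"
  "U_2_3_123 $ {2, 3} = 2" "U_2_3_123 $ {2, 4} = 1" "U_2_3_123 $ {3, 4} = 1"
  "U_2_3_123 $ {1, 2, 3} = 2" "U_2_3_123 $ {1, 2, 4} = 2" "U_2_3_123 $ {1, 3, 4} = 2"
  "U_2_3_123 $ {2, 3, 4} = 2" "U_2_3_123 $ {1, 2, 3, 4} = 2"
  by (simp_all add: U_hat_3_5_1_def U_2_3_123_def Int_insert_left)

lemma face_point_nth [simp]: "face_point r1 r2 a b $ A = a * r1 $ A + b * r2 $ A"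
  by (simp add: face_point_def)

lemma truncated_modular_in_Gamma4:
  fixes m :: "4 set \<Rightarrow> real"
  assumes "0 \<le> k" "m {} = 0" and mono: "\<And>A B. A \<subseteq> B \<Longrightarrow> m A \<le> m B"
    and modular: "\<And>A B. m (A \<union> B) + m (A \<inter> B) = m A + m B"
  shows "(\<chi> A. min k (m A)) \<in> Gamma4"
proof -
  have "min k (m (A \<union> B)) + min k (m (A \<inter> B)) \<le> min k (m A) + min k (m B)" for A B
    using modular[of A B] mono[of A "A \<union> B"] mono[of B "A \<union> B"] mono[of "A \<inter> B" A]
      mono[of "A \<inter> B" B] by (auto simp: min_def)
  moreover have "min k (m A) \<le> min k (m B)" if "A \<subseteq> B" for A B
    using mono[OF that] by simp
  ultimately show ?thesis
    using assms(1,2) by (simp add: Gamma4_def)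
qed

lemma U_2_3_123_in_Gamma4: "U_2_3_123 \<in> Gamma4"
  unfolding U_2_3_123_def
proof (rule truncated_modular_in_Gamma4)
  fix A B :: "4 set"
  show "real (card (A \<inter> {1, 2, 3})) \<le> real (card (B \<inter> {1, 2, 3}))" if "A \<subseteq> B"
    using card_mono[of "B \<inter> {1, 2, 3}" "A \<inter> {1, 2, 3}"] that by auto
  have "card (A \<inter> {1, 2, 3}) + card (B \<inter> {1, 2, 3}) =
      card (A \<inter> {1, 2, 3} \<union> B \<inter> {1, 2, 3}) + card (A \<inter> {1, 2, 3} \<inter> (B \<inter> {1, 2, 3}))"
    by (rule card_Un_Int) simp_all
  also have "A \<inter> {1, 2, 3} \<union> B \<inter> {1, 2, 3} = (A \<union> B) \<inter> {1, 2, 3}" by blast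
  also have "A \<inter> {1, 2, 3} \<inter> (B \<inter> {1, 2, 3}) = A \<inter> B \<inter> {1, 2, 3}" by blast
  finally show "real (card ((A \<union> B) \<inter> {1, 2, 3})) + real (card (A \<inter> B \<inter> {1, 2, 3})) =
      real (card (A \<inter> {1, 2, 3})) + real (card (B \<inter> {1, 2, 3}))"
    by linarith
qed simp_all

lemma U_hat_3_5_1_in_Gamma4: "U_hat_3_5_1 \<in> Gamma4"
proof -
  let ?m = "\<lambda>A :: 4 set. real (card A) + of_bool (1 \<in> A)"
  have "U_hat_3_5_1 = (\<chi> A. min 3 (?m A))"
    by (simp only: vec_eq_iff all_4_set ranks_values) simp
  also have "\<dots> \<in> Gamma4"
  proof (rule truncated_modular_in_Gamma4)
    fix A B :: "4 set"
    show "?m A \<le> ?m B" if "A \<subseteq> B"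
      using that card_mono[of B A] by (auto simp: of_bool_def)
    show "?m (A \<union> B) + ?m (A \<inter> B) = ?m A + ?m B"
      using card_Un_Int[of A B] by (auto simp: of_bool_def)
  qed simp_all
  finally show ?thesis .
qed

text \<open>The points spanned by the two rank functions do form a face of \<^const>\<open>Gamma4\<close>.\<close>

lemma spanned_face_subset_Gamma4: "spanned_face U_hat_3_5_1 U_2_3_123 \<subseteq> Gamma4"
proof
  fix h
  assume "h \<in> spanned_face U_hat_3_5_1 U_2_3_123"
  then obtain a b where ab: "0 \<le> a" "0 \<le> b" and h: "h = face_point U_hat_3_5_1 U_2_3_123 a b"
    by (auto simp: spanned_face_def)
  let ?r = U_hat_3_5_1 and ?s = U_2_3_123
  have "h $ A \<le> h $ B" if "A \<subseteq> B" for A B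
    using ab U_hat_3_5_1_in_Gamma4 U_2_3_123_in_Gamma4 that
    by (auto simp: h Gamma4_def intro!: add_mono mult_left_mono)
  moreover have "h $ (A \<union> B) + h $ (A \<inter> B) \<le> h $ A + h $ B" for A B
  proof -
    have "a * (?r $ (A \<union> B) + ?r $ (A \<inter> B)) \<le> a * (?r $ A + ?r $ B)"
      "b * (?s $ (A \<union> B) + ?s $ (A \<inter> B)) \<le> b * (?s $ A + ?s $ B)"
      using ab U_hat_3_5_1_in_Gamma4 U_2_3_123_in_Gamma4
      by (auto simp: Gamma4_def intro!: mult_left_mono)
    then show ?thesis
      by (simp add: h algebra_simps)
  qed
  ultimately show "h \<in> Gamma4"
    by (simp add: Gamma4_def h ranks_values)
qed

definition satisfies_tight_eqs :: "set_function \<Rightarrow> bool" where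
  "satisfies_tight_eqs h \<longleftrightarrow> h $ {1, 2} = h $ {1, 2, 3, 4} \<and> h $ {1, 3} = h $ {1, 2, 3, 4} \<and>
     h $ {2, 3, 4} = h $ {1, 2, 3, 4} \<and> h $ {1, 2} = h $ {1} + h $ {2} \<and>
     h $ {1, 3} = h $ {1} + h $ {3} \<and> h $ {1, 4} = h $ {1} + h $ {4} \<and>
     h $ {2, 3} = h $ {2} + h $ {3} \<and> h $ {2, 4} = h $ {2} + h $ {4} \<and>
     h $ {3, 4} = h $ {3} + h $ {4} \<and> h $ {2, 3, 4} = h $ {2, 3} + h $ {4}"

lemma Gamma4_mono: "h \<in> Gamma4 \<Longrightarrow> A \<subseteq> B \<Longrightarrow> h $ A \<le> h $ B"
  by (simp add: Gamma4_def)

lemma Gamma4_subadditive: "h \<in> Gamma4 \<Longrightarrow> A \<inter> B = {} \<Longrightarrow> h $ (A \<union> B) \<le> h $ A + h $ B"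
  unfolding Gamma4_def mem_Collect_eq by (metis add_0_right)

lemma spanned_face_eq: "spanned_face U_hat_3_5_1 U_2_3_123 = {h \<in> Gamma4. satisfies_tight_eqs h}"
proof (intro subset_antisym subsetI)
  fix h
  assume "h \<in> spanned_face U_hat_3_5_1 U_2_3_123"
  moreover from this have "h \<in> Gamma4"
    using spanned_face_subset_Gamma4 by blast
  ultimately show "h \<in> {h \<in> Gamma4. satisfies_tight_eqs h}"
    by (auto simp: spanned_face_def satisfies_tight_eqs_def ranks_values)
next
  fix h
  assume "h \<in> {h \<in> Gamma4. satisfies_tight_eqs h}"
  then have h: "h \<in> Gamma4" and t: "satisfies_tight_eqs h" by auto
  define a b where "a = h $ {4}" and "b = h $ {2} - h $ {4}"
  have "h $ {} = 0" using h by (simp add: Gamma4_def)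
  moreover have "h $ {} \<le> h $ {4}" "h $ {1, 4} \<le> h $ {1, 2, 3, 4}"
    "h $ {1, 2} \<le> h $ {1, 2, 3}" "h $ {1, 2, 3} \<le> h $ {1, 2, 3, 4}"
    "h $ {1, 2} \<le> h $ {1, 2, 4}" "h $ {1, 2, 4} \<le> h $ {1, 2, 3, 4}"
    "h $ {1, 3} \<le> h $ {1, 3, 4}" "h $ {1, 3, 4} \<le> h $ {1, 2, 3, 4}"
    by (rule Gamma4_mono[OF h]; blast)+
  ultimately have "0 \<le> a \<and> 0 \<le> b \<and> h = face_point U_hat_3_5_1 U_2_3_123 a b"
    using t unfolding satisfies_tight_eqs_def a_def b_def
    by (simp only: vec_eq_iff all_4_set ranks_values face_point_nth left_diff_distrib)
      (elim conjE, intro conjI TrueI; linarith)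
  then show "h \<in> spanned_face U_hat_3_5_1 U_2_3_123"
    by (auto simp: spanned_face_def)
qed

lemma convex_combination_tight:
  fixes s t s' t' u :: real
  assumes "s \<le> t" "s' \<le> t'" "0 < u" "u < 1"
    and "(1 - u) * s + u * s' = (1 - u) * t + u * t'"
  shows "s = t \<and> s' = t'"
proof -
  have "(1 - u) * s \<le> (1 - u) * t" "u * s' \<le> u * t'"
    using assms by simp_all
  then have "(1 - u) * s = (1 - u) * t" "u * s' = u * t'"
    using assms(5) by linarith+
  then show ?thesis using assms by simp
qed

lemma spanned_face_face_of_Gamma4: "spanned_face U_hat_3_5_1 U_2_3_123 face_of Gamma4"
  unfolding face_of_def
proof (intro conjI ballI impI)
  show "spanned_face U_hat_3_5_1 U_2_3_123 \<subseteq> Gamma4"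
    by (rule spanned_face_subset_Gamma4)
  show "convex (spanned_face U_hat_3_5_1 U_2_3_123)"
  proof (rule convexI)
    fix x y :: set_function and u v :: real
    assume uv: "0 \<le> u" "0 \<le> v" and "x \<in> spanned_face U_hat_3_5_1 U_2_3_123"
      "y \<in> spanned_face U_hat_3_5_1 U_2_3_123"
    then obtain a b c d where "0 \<le> a" "0 \<le> b" "0 \<le> c" "0 \<le> d"
      "x = face_point U_hat_3_5_1 U_2_3_123 a b" "y = face_point U_hat_3_5_1 U_2_3_123 c d"
      by (auto simp: spanned_face_def)
    moreover from this have "u *\<^sub>R x + v *\<^sub>R y =
        face_point U_hat_3_5_1 U_2_3_123 (u * a + v * c) (u * b + v * d)"
      by (simp add: face_point_def algebra_simps)
    ultimately show "u *\<^sub>R x + v *\<^sub>R y \<in> spanned_face U_hat_3_5_1 U_2_3_123"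
      using uv unfolding spanned_face_def by (blast intro: add_nonneg_nonneg mult_nonneg_nonneg)
  qed
  fix g h x
  assume g: "g \<in> Gamma4" and h: "h \<in> Gamma4" and x: "x \<in> spanned_face U_hat_3_5_1 U_2_3_123"
    and seg: "x \<in> open_segment g h"
  from seg obtain u where u: "0 < u" "u < 1" and xu: "x = (1 - u) *\<^sub>R g + u *\<^sub>R h"
    by (auto simp: in_segment)
  have eqx: "x $ A = (1 - u) * g $ A + u * h $ A" for A
    by (simp add: xu)
  have "satisfies_tight_eqs x" using x by (simp add: spanned_face_eq)
  have mono: "g $ A = g $ B \<and> h $ A = h $ B" if "A \<subseteq> B" "x $ A = x $ B" for A B
    using that u eqx Gamma4_mono[OF g] Gamma4_mono[OF h]
    by (intro convex_combination_tight[of _ _ _ _ u]) auto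
  have sub: "g $ C = g $ A + g $ B \<and> h $ C = h $ A + h $ B"
    if "A \<union> B = C" "A \<inter> B = {}" "x $ C = x $ A + x $ B" for A B C
    using that u eqx Gamma4_subadditive[OF g, of A B] Gamma4_subadditive[OF h, of A B]
    by (intro convex_combination_tight[of _ _ _ _ u]) (auto simp: algebra_simps)
  note t = \<open>satisfies_tight_eqs x\<close>[unfolded satisfies_tight_eqs_def]
  have "g $ {1, 2} = g $ {1, 2, 3, 4} \<and> h $ {1, 2} = h $ {1, 2, 3, 4}"
    "g $ {1, 3} = g $ {1, 2, 3, 4} \<and> h $ {1, 3} = h $ {1, 2, 3, 4}"
    "g $ {2, 3, 4} = g $ {1, 2, 3, 4} \<and> h $ {2, 3, 4} = h $ {1, 2, 3, 4}"
    by (rule mono; (blast | simp only: t))+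
  moreover have "g $ {1, 2} = g $ {1} + g $ {2} \<and> h $ {1, 2} = h $ {1} + h $ {2}"
    "g $ {1, 3} = g $ {1} + g $ {3} \<and> h $ {1, 3} = h $ {1} + h $ {3}"
    "g $ {1, 4} = g $ {1} + g $ {4} \<and> h $ {1, 4} = h $ {1} + h $ {4}"
    "g $ {2, 3} = g $ {2} + g $ {3} \<and> h $ {2, 3} = h $ {2} + h $ {3}"
    "g $ {2, 4} = g $ {2} + g $ {4} \<and> h $ {2, 4} = h $ {2} + h $ {4}"
    "g $ {3, 4} = g $ {3} + g $ {4} \<and> h $ {3, 4} = h $ {3} + h $ {4}"
    "g $ {2, 3, 4} = g $ {2, 3} + g $ {4} \<and> h $ {2, 3, 4} = h $ {2, 3} + h $ {4}"
    by (rule sub; insert t; auto)+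
  ultimately have "satisfies_tight_eqs g \<and> satisfies_tight_eqs h"
    by (simp only: satisfies_tight_eqs_def)
  then show "g \<in> spanned_face U_hat_3_5_1 U_2_3_123" "h \<in> spanned_face U_hat_3_5_1 U_2_3_123"
    using g h by (simp_all add: spanned_face_eq)
qed

end

(*
  Tightness of the rank equations says that X2, X3, X4 are
  independent, that X1 is independent of each of them, and that (X1,X2), (X1,X3) and (X2,X3,X4)
  each determine everything. On the support this gives p(x1) p(x2) = p(x1) p(x3) = p(x2) p(x3) p(x4).
  Cancelling p(x1) and using that X2, X3 are independent shows that X2 and X3 are uniform with one
  common weight c; then p(x1) = c p(x4), and independence of X1 and X4 makes X4 uniform, with
  weight d. Given positive (x1,x4), the mass p(x1) p(x4) is shared by K atoms of mass p(x1) c, so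
  d = K c; hence a = - log d = log v1, and b = H(X2) - H(X4) = log (d/c) = log K.

  Conversely, let p, q, r be uniform on Z/v1 and s, t uniform on Z/v2, all independent. Take
  X2 = (p,s), X3 = (q,t), X4 = r and X1 = (p+q, q+r, s+t).
*)

theory Submission
  imports Defs
begin

section \<open>Equality in the Gibbs inequality\<close>

text \<open>Since ln x \<le> x - 1, each term \<open>q i - p i - p i * ln (q i / p i)\<close> is
  nonnegative, while the hypotheses make the sum of these terms at most 0. So every term vanishes;
  where \<open>p i = 0\<close> the term is just \<open>q i\<close>, and elsewhere ln x = x - 1
  forces x = 1.\<close>

lemma gibbs_equality:
  fixes p q :: "'i \<Rightarrow> real"
  assumes "1 < b" and "finite S" and p: "\<And>i. i \<in> S \<Longrightarrow> 0 \<le> p i" and q: "\<And>i. i \<in> S \<Longrightarrow> 0 \<le> q i"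
    and pq: "\<And>i. i \<in> S \<Longrightarrow> p i \<noteq> 0 \<Longrightarrow> 0 < q i"
    and "sum q S \<le> sum p S" and "0 \<le> (\<Sum>i\<in>S. p i * (log b (q i) - log b (p i)))" and "i \<in> S"
  shows "p i = q i"
proof -
  have ln_ratio: "ln b * (p i * (log b (q i) - log b (p i))) = p i * ln (q i / p i)" if "i \<in> S" for i
  proof (cases "p i = 0")
    case False
    then have "0 < p i" "0 < q i" using p[OF that] pq[OF that] by auto
    then show ?thesis using \<open>1 < b\<close> by (simp add: log_def ln_div field_simps)
  qed simp
  have le: "0 \<le> q i - p i - p i * ln (q i / p i)" if "i \<in> S" for i
  proof (cases "p i = 0")
    case False
    then have "p i * ln (q i / p i) \<le> p i * (q i / p i - 1)"
      using p pq that by (intro mult_left_mono ln_le_minus_one) (auto simp: less_le)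
    with False show ?thesis by (simp add: algebra_simps)
  qed (use q that in simp)
  have "0 \<le> ln b * (\<Sum>i\<in>S. p i * (log b (q i) - log b (p i)))"
    using assms(1,7) by simp
  also have "\<dots> = (\<Sum>i\<in>S. p i * ln (q i / p i))"
    by (simp add: sum_distrib_left ln_ratio)
  finally have "(\<Sum>i\<in>S. q i - p i - p i * ln (q i / p i)) \<le> 0"
    using assms(6) by (simp add: sum_subtractf)
  moreover have "0 \<le> (\<Sum>i\<in>S. q i - p i - p i * ln (q i / p i))"
    by (rule sum_nonneg) (rule le)
  ultimately have "(\<Sum>i\<in>S. q i - p i - p i * ln (q i / p i)) = 0"
    by linarith
  then have eq: "q i - p i - p i * ln (q i / p i) = 0"
    using sum_nonneg_eq_0_iff[OF \<open>finite S\<close> le] \<open>i \<in> S\<close> by simp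
  show ?thesis
  proof (cases "p i = 0")
    case False
    then have "ln (q i / p i) = q i / p i - 1"
      using eq by (simp add: field_simps)
    moreover have "0 < q i / p i"
      using p pq \<open>i \<in> S\<close> False by (simp add: less_le)
    ultimately show ?thesis
      using ln_eq_minus_one False by fastforce
  qed (use eq in simp)
qed

section \<open>Point probabilities and marginals\<close>

abbreviation (in prob_space) point_prob :: "('a \<Rightarrow> 'b) \<Rightarrow> 'b \<Rightarrow> real" where
  "point_prob X x \<equiv> prob (X -` {x} \<inter> space M)"

lemma (in prob_space) point_prob_eq_0: "x \<notin> X ` space M \<Longrightarrow> point_prob X x = 0"
proof -
  assume "x \<notin> X ` space M"
  then have "X -` {x} \<inter> space M = {}" by auto
  then show ?thesis by simp
qed

lemma (in prob_space) sum_point_prob: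
  assumes "simple_function M X"
  shows "(\<Sum>x\<in>X ` space M. point_prob X x) = 1"
  by (rule simple_distributed_sum_space[OF simple_distributedI[OF assms measure_nonneg refl]])

lemma (in prob_space) ex_point_prob_pos:
  assumes "simple_function M X"
  shows "\<exists>x. 0 < point_prob X x"
proof (rule ccontr)
  assume "\<not> ?thesis"
  then have "point_prob X x = 0" for x
    by (simp add: zero_less_measure_iff)
  with sum_point_prob[OF assms] show False by simp
qed

lemma (in prob_space) point_prob_marginal:
  assumes X: "simple_function M X" and Y: "simple_function M Y"
  shows "point_prob X x = (\<Sum>y\<in>Y ` space M. point_prob (\<lambda>\<omega>. (X \<omega>, Y \<omega>)) (x, y))"
proof -
  have "X -` {x} \<inter> space M = (\<Union>y\<in>Y ` space M. (\<lambda>\<omega>. (X \<omega>, Y \<omega>)) -` {(x, y)} \<inter> space M)"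
    by auto
  also have "prob \<dots> = (\<Sum>y\<in>Y ` space M. point_prob (\<lambda>\<omega>. (X \<omega>, Y \<omega>)) (x, y))"
    using simple_functionD[OF simple_function_Pair[OF X Y]] simple_functionD(1)[OF Y]
    by (intro finite_measure_finite_Union) (auto simp: disjoint_family_on_def)
  finally show ?thesis .
qed

text \<open>A positive marginal is a sum of joint probabilities, so one of them is nonzero. This
  completes a partial outcome of positive mass to a full one.\<close>

lemma (in prob_space) point_prob_pos_extend:
  assumes "simple_function M X" "simple_function M Y" "0 < point_prob X x"
  obtains y where "0 < point_prob (\<lambda>\<omega>. (X \<omega>, Y \<omega>)) (x, y)"
proof -
  have "\<exists>y\<in>Y ` space M. point_prob (\<lambda>\<omega>. (X \<omega>, Y \<omega>)) (x, y) \<noteq> 0"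
    using assms(3) unfolding point_prob_marginal[OF assms(1,2)]
    by (metis (no_types, lifting) less_irrefl sum.neutral)
  then show ?thesis using that by (auto simp: zero_less_measure_iff)
qed

lemma (in prob_space) point_prob_joint_le:
  assumes "simple_function M X" "simple_function M Y"
  shows "point_prob (\<lambda>\<omega>. (X \<omega>, Y \<omega>)) (x, y) \<le> point_prob X x"
    and "point_prob (\<lambda>\<omega>. (X \<omega>, Y \<omega>)) (x, y) \<le> point_prob Y y"
  by (intro finite_measure_mono simple_functionD(2) assms; auto)+

section \<open>Equality cases for Shannon entropy\<close>

lemma (in information_space) entropy_eq_point_prob:
  assumes "simple_function M X"
  shows "\<H>(X) = - (\<Sum>x\<in>X ` space M. point_prob X x * log b (point_prob X x))"
  by (rule entropy_simple_distributed[OF simple_distributedI[OF assms measure_nonneg refl]])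

text \<open>Additivity says that the relative entropy of the joint distribution with respect to the
  product of the marginals is 0, so the equality case of Gibbs applies. Outside the ranges of
  \<open>X\<close> and \<open>Y\<close> both sides are 0.\<close>

lemma (in information_space) point_prob_Pair_if_entropy_add:
  assumes X: "simple_function M X" and Y: "simple_function M Y"
    and H: "\<H>(\<lambda>\<omega>. (X \<omega>, Y \<omega>)) = \<H>(X) + \<H>(Y)"
  shows "point_prob (\<lambda>\<omega>. (X \<omega>, Y \<omega>)) (x, y) = point_prob X x * point_prob Y y"
proof (cases "x \<in> X ` space M \<and> y \<in> Y ` space M")
  case True
  define S where "S = X ` space M \<times> Y ` space M"
  define r where "r = point_prob (\<lambda>\<omega>. (X \<omega>, Y \<omega>))"
  note XY = simple_function_Pair[OF X Y]
  have fin: "finite (X ` space M)" "finite (Y ` space M)" "finite S"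
    using X Y by (auto simp: S_def simple_functionD)
  have mX: "point_prob X x = (\<Sum>y\<in>Y ` space M. r (x, y))" for x
    unfolding r_def by (rule point_prob_marginal[OF X Y])
  have mY: "point_prob Y y = (\<Sum>x\<in>X ` space M. r (x, y))" for y
    unfolding r_def point_prob_marginal[OF Y X]
    by (intro sum.cong arg_cong[where f=prob]) auto
  \<comment> \<open>Pairs of \<open>S\<close> that are never attained have probability 0 and
    contribute nothing, so the sum may run over the whole product.\<close>
  have HXY: "\<H>(\<lambda>\<omega>. (X \<omega>, Y \<omega>)) = - (\<Sum>z\<in>S. r z * log b (r z))"
    unfolding entropy_eq_point_prob[OF XY] r_def S_def using fin
    by (intro arg_cong[where f=uminus] sum.mono_neutral_left) (auto simp: point_prob_eq_0)
  \<comment> \<open>Only the factor outside the logarithm is expanded as a marginal sum; this puts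
    all three entropies over \<open>S\<close> with the same weight \<open>r\<close>.\<close>
  have HX: "\<H>(X) = - (\<Sum>z\<in>S. r z * log b (point_prob X (fst z)))"
    unfolding entropy_eq_point_prob[OF X] S_def
    by (subst (1) mX) (simp add: sum_distrib_right sum.cartesian_product split_beta)
  have HY: "\<H>(Y) = - (\<Sum>z\<in>S. r z * log b (point_prob Y (snd z)))"
    unfolding entropy_eq_point_prob[OF Y] S_def
    by (subst (1) mY, subst sum_distrib_right, subst sum.swap) (simp add: sum.cartesian_product split_beta)
  define q where "q z = point_prob X (fst z) * point_prob Y (snd z)" for z
  have le: "r z \<le> point_prob X (fst z)" "r z \<le> point_prob Y (snd z)" for z
    unfolding r_def using point_prob_joint_le[OF X Y, of "fst z" "snd z"] by simp_all
  have r0: "0 \<le> r z" for z by (simp add: r_def)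
  have pos: "0 < point_prob X (fst z)" "0 < point_prob Y (snd z)" if "r z \<noteq> 0" for z
    using le[of z] r0[of z] that by linarith+
  have "r (x, y) = q (x, y)"
  proof (rule gibbs_equality[OF b_gt_1 fin(3)])
    have "sum r S = 1"
      using sum_point_prob[OF X] by (simp add: mX S_def sum.cartesian_product)
    moreover have "sum q S = 1"
      using sum_point_prob[OF X] sum_point_prob[OF Y]
        sum_product[of "point_prob X" "X ` space M" "point_prob Y" "Y ` space M"]
      by (simp add: q_def S_def sum.cartesian_product split_beta)
    ultimately show "sum q S \<le> sum r S" by simp
    \<comment> \<open>The logarithm of the product splits only where both marginals are positive;
      where \<open>r z = 0\<close> the weight removes the term.\<close>
    have log_ratio: "r z * (log b (q z) - log b (r z)) = r z * log b (point_prob X (fst z)) +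
        r z * log b (point_prob Y (snd z)) - r z * log b (r z)" for z
    proof (cases "r z = 0")
      case False
      then have "log b (q z) = log b (point_prob X (fst z)) + log b (point_prob Y (snd z))"
        using pos[OF False] by (simp add: q_def log_mult_pos)
      then show ?thesis by (simp only: distrib_left right_diff_distrib)
    qed simp
    have "(\<Sum>z\<in>S. r z * (log b (q z) - log b (r z))) = 0"
      using H unfolding log_ratio HXY HX HY sum.distrib sum_subtractf by linarith
    then show "0 \<le> (\<Sum>z\<in>S. r z * (log b (q z) - log b (r z)))" by simp
    show "0 < q z" if "r z \<noteq> 0" for z using pos[OF that] by (simp add: q_def)
  qed (use True r0 in \<open>auto simp: S_def q_def\<close>)
  then show ?thesis by (simp add: r_def q_def)
next
  case False
  then have "point_prob X x * point_prob Y y = 0"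
    using point_prob_eq_0[of x X] point_prob_eq_0[of y Y] by auto
  moreover have "(x, y) \<notin> (\<lambda>\<omega>. (X \<omega>, Y \<omega>)) ` space M"
    using False by auto
  ultimately show ?thesis
    using point_prob_eq_0[of "(x, y)" "\<lambda>\<omega>. (X \<omega>, Y \<omega>)"] by simp
qed

text \<open>The difference of the two entropies is a sum of terms
  \<open>r z * (log b (point_prob X (fst z)) - log b (r z))\<close>, each nonnegative because a
  joint probability is at most its marginal. If the sum is 0, the logarithms agree wherever
  \<open>r z\<close> is positive.\<close>

lemma (in information_space) point_prob_Pair_if_entropy_eq:
  assumes X: "simple_function M X" and Y: "simple_function M Y"
    and H: "\<H>(\<lambda>\<omega>. (X \<omega>, Y \<omega>)) = \<H>(X)"
    and pos: "0 < point_prob (\<lambda>\<omega>. (X \<omega>, Y \<omega>)) (x, y)"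
  shows "point_prob (\<lambda>\<omega>. (X \<omega>, Y \<omega>)) (x, y) = point_prob X x"
proof -
  define S where "S = X ` space M \<times> Y ` space M"
  define r where "r = point_prob (\<lambda>\<omega>. (X \<omega>, Y \<omega>))"
  note XY = simple_function_Pair[OF X Y]
  have fin: "finite S"
    using X Y by (auto simp: S_def simple_functionD)
  have mX: "point_prob X x = (\<Sum>y\<in>Y ` space M. r (x, y))" for x
    unfolding r_def by (rule point_prob_marginal[OF X Y])
  have HXY: "\<H>(\<lambda>\<omega>. (X \<omega>, Y \<omega>)) = - (\<Sum>z\<in>S. r z * log b (r z))"
    unfolding entropy_eq_point_prob[OF XY] r_def S_def using fin[unfolded S_def]
    by (intro arg_cong[where f=uminus] sum.mono_neutral_left) (auto simp: point_prob_eq_0)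
  have HX: "\<H>(X) = - (\<Sum>z\<in>S. r z * log b (point_prob X (fst z)))"
    unfolding entropy_eq_point_prob[OF X] S_def
    by (subst (1) mX) (simp add: sum_distrib_right sum.cartesian_product split_beta)
  have le: "r z \<le> point_prob X (fst z)" for z
    unfolding r_def using point_prob_joint_le(1)[OF X Y, of "fst z" "snd z"] by simp
  have r0: "0 \<le> r z" for z by (simp add: r_def)
  have nonneg: "0 \<le> r z * (log b (point_prob X (fst z)) - log b (r z))" for z
  proof (cases "r z = 0")
    case False
    then have "0 < r z" "0 < point_prob X (fst z)"
      using le[of z] r0[of z] by linarith+
    with le[of z] show ?thesis
      using b_gt_1 by simp
  qed simp
  have "(\<Sum>z\<in>S. r z * (log b (point_prob X (fst z)) - log b (r z))) = 0"
    using H unfolding HXY HX by (simp add: right_diff_distrib sum_subtractf)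
  moreover have "(x, y) \<in> S"
    using pos point_prob_eq_0[of "(x, y)" "\<lambda>\<omega>. (X \<omega>, Y \<omega>)"] by (fastforce simp: S_def)
  ultimately have "r (x, y) * (log b (point_prob X x) - log b (r (x, y))) = 0"
    using sum_nonneg_eq_0_iff[OF fin nonneg] by fastforce
  moreover have "0 < r (x, y)" using pos by (simp add: r_def)
  moreover have "0 < point_prob X x" using \<open>0 < r (x, y)\<close> le[of "(x, y)"] by simp
  ultimately have "log b (point_prob X x) = log b (r (x, y))" by simp
  with \<open>0 < r (x, y)\<close> \<open>0 < point_prob X x\<close> show ?thesis
    using b_gt_1 powr_log_cancel[of b] unfolding r_def by (metis less_trans less_irrefl zero_less_one)
qed

lemma (in information_space) entropy_if_point_prob_const:
  assumes X: "simple_function M X" and u: "\<And>x. 0 < point_prob X x \<Longrightarrow> point_prob X x = c"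
  obtains n :: nat where "0 < n" "c = 1 / real n" "\<H>(X) = log b (real n)"
proof -
  define n where "n = card {x \<in> X ` space M. 0 < point_prob X x}"
  have fin: "finite (X ` space M)" using X by (rule simple_functionD)
  \<comment> \<open>The condition \<open>f 0 = 0\<close> discards the values of mass 0. The identity
    for \<open>f\<close> yields \<open>real n * c = 1\<close>, and x log x yields the
    entropy.\<close>
  have S: "(\<Sum>x\<in>X ` space M. f (point_prob X x)) = real n * f c" if "f 0 = 0" for f :: "real \<Rightarrow> real"
  proof -
    have "(\<Sum>x\<in>X ` space M. f (point_prob X x)) = (\<Sum>x | x \<in> X ` space M \<and> 0 < point_prob X x. f (point_prob X x))"
      using fin that by (intro sum.mono_neutral_right) (auto simp: zero_less_measure_iff)
    also have "\<dots> = (\<Sum>x | x \<in> X ` space M \<and> 0 < point_prob X x. f c)"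
      using u by (intro sum.cong) auto
    finally show ?thesis by (simp add: n_def)
  qed
  have nc: "real n * c = 1" using S[of "\<lambda>x. x"] sum_point_prob[OF X] by simp
  then have "0 < n" by (auto intro: gr0I)
  with nc have "c = 1 / real n" by (simp add: field_simps)
  have "\<H>(X) = log b (real n)"
    unfolding entropy_eq_point_prob[OF X]
    using S[of "\<lambda>x. x * log b x"] nc \<open>0 < n\<close> \<open>c = 1 / real n\<close> by (simp add: log_divide)
  with that \<open>0 < n\<close> \<open>c = 1 / real n\<close> show ?thesis by blast
qed

section \<open>Tight entropies force logarithms of integers\<close>

text \<open>Entropy depends only on the partition into level sets. This replaces
  \<open>subvector X A\<close> by a single coordinate or by a nested pair of coordinates.\<close>

lemma entropy_function_eqI:
  fixes X :: "4 \<Rightarrow> 'a \<Rightarrow> 'b" and Y :: "'a \<Rightarrow> 'c"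
  assumes M: "prob_space M" and X: "\<And>i. simple_function M (X i)"
    and kernel: "\<And>\<omega> \<omega>'. Y \<omega> = Y \<omega>' \<longleftrightarrow> (\<forall>i\<in>A. X i \<omega> = X i \<omega>')"
  shows "entropy_function M X $ A = prob_space.entropy M 2 (count_space (Y ` space M)) Y"
proof -
  interpret information_space M 2
    using M by (simp add: information_space_def information_space_axioms_def)
  have sub: "subvector X A \<omega> = subvector X A \<omega>' \<longleftrightarrow> Y \<omega> = Y \<omega>'" for \<omega> \<omega>'
    unfolding kernel by (auto simp: subvector_def restrict_def fun_eq_iff)
  \<comment> \<open>The value does not depend on the chosen outcome, because \<open>Y\<close> is
    constant on the level sets of \<open>subvector X A\<close>.\<close>
  define f where "f g = Y (SOME \<omega>. subvector X A \<omega> = g)" for g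
  have "f (subvector X A \<omega>) = Y \<omega>" for \<omega>
    unfolding f_def by (rule someI2[of _ \<omega>]) (simp_all add: sub)
  then have f: "f \<circ> subvector X A = Y" by auto
  have "inj_on f (subvector X A ` space M)"
    using f sub by (auto simp: inj_on_def fun_eq_iff)
  from entropy_of_inj[OF simple_function_subvector[OF X] this] show ?thesis
    by (simp add: f entropy_function_def)
qed

text \<open>\<open>X\<close>, \<open>Y\<close>, \<open>Z\<close>, \<open>W\<close> play the roles of
  X1, X2, X3, X4. The number \<open>m\<close> counts the values of \<open>W\<close> of positive
  mass, and \<open>n\<close> counts the pairs of values of \<open>Y\<close> and \<open>Z\<close>
  compatible with one fixed pair of values of \<open>X\<close> and \<open>W\<close>.\<close>

lemma (in information_space) tight_entropies_eq_log_nat: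
  fixes X Y Z W :: "'a \<Rightarrow> 'c"
  assumes sf: "simple_function M X" "simple_function M Y" "simple_function M Z" "simple_function M W"
    and XY: "\<H>(\<lambda>\<omega>. (X \<omega>, Y \<omega>)) = \<H>(X) + \<H>(Y)"
    and XZ: "\<H>(\<lambda>\<omega>. (X \<omega>, Z \<omega>)) = \<H>(X) + \<H>(Z)"
    and XW: "\<H>(\<lambda>\<omega>. (X \<omega>, W \<omega>)) = \<H>(X) + \<H>(W)"
    and YZ: "\<H>(\<lambda>\<omega>. (Y \<omega>, Z \<omega>)) = \<H>(Y) + \<H>(Z)"
    and YZ_W: "\<H>(\<lambda>\<omega>. ((Y \<omega>, Z \<omega>), W \<omega>)) = \<H>(\<lambda>\<omega>. (Y \<omega>, Z \<omega>)) + \<H>(W)"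
    and XY_det: "\<H>(\<lambda>\<omega>. ((X \<omega>, Y \<omega>), (Z \<omega>, W \<omega>))) = \<H>(\<lambda>\<omega>. (X \<omega>, Y \<omega>))"
    and XZ_det: "\<H>(\<lambda>\<omega>. ((X \<omega>, Z \<omega>), (Y \<omega>, W \<omega>))) = \<H>(\<lambda>\<omega>. (X \<omega>, Z \<omega>))"
    and YZW_det: "\<H>(\<lambda>\<omega>. (((Y \<omega>, Z \<omega>), W \<omega>), X \<omega>)) = \<H>(\<lambda>\<omega>. ((Y \<omega>, Z \<omega>), W \<omega>))"
  obtains m n :: nat where "0 < m" "0 < n" "\<H>(W) = log b (real m)"
    "\<H>(Y) = log b (real m) + log b (real n)"
proof -
  note sf2 = simple_function_Pair[OF sf(1,2)] simple_function_Pair[OF sf(1,3)]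
    simple_function_Pair[OF sf(1,4)] simple_function_Pair[OF sf(2,3)]
    simple_function_Pair[OF sf(2,4)] simple_function_Pair[OF sf(3,4)]
    simple_function_Pair[OF simple_function_Pair[OF sf(2,3)] sf(4)]
  note indep = point_prob_Pair_if_entropy_add[OF sf(1,2) XY] point_prob_Pair_if_entropy_add[OF sf(1,3) XZ]
    point_prob_Pair_if_entropy_add[OF sf(1,4) XW] point_prob_Pair_if_entropy_add[OF sf(2,3) YZ]
    point_prob_Pair_if_entropy_add[OF sf2(4) sf(4) YZ_W]
  define P where "P x y z w = point_prob (\<lambda>\<omega>. (X \<omega>, Y \<omega>, Z \<omega>, W \<omega>)) (x, y, z, w)" for x y z w
  \<comment> \<open>The entropy hypotheses bracket the four coordinates differently, but every
    bracketing describes the same event.\<close>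
  have P1: "point_prob (\<lambda>\<omega>. ((X \<omega>, Y \<omega>), (Z \<omega>, W \<omega>))) ((x, y), (z, w)) = P x y z w"
    and P2: "point_prob (\<lambda>\<omega>. ((X \<omega>, Z \<omega>), (Y \<omega>, W \<omega>))) ((x, z), (y, w)) = P x y z w"
    and P3: "point_prob (\<lambda>\<omega>. (((Y \<omega>, Z \<omega>), W \<omega>), X \<omega>)) (((y, z), w), x) = P x y z w"
    and P4: "point_prob (\<lambda>\<omega>. ((X \<omega>, W \<omega>), (Y \<omega>, Z \<omega>))) ((x, w), (y, z)) = P x y z w"
    for x y z w
    unfolding P_def by (rule arg_cong[where f=prob], auto)+
  have eq: "P x y z w = point_prob X x * point_prob Y y"
    "P x y z w = point_prob X x * point_prob Z z"
    "P x y z w = point_prob Y y * point_prob Z z * point_prob W w" if "0 < P x y z w" for x y z w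
    using point_prob_Pair_if_entropy_eq[OF sf2(1) sf2(6) XY_det, of "(x, y)" "(z, w)"]
      point_prob_Pair_if_entropy_eq[OF sf2(2) sf2(5) XZ_det, of "(x, z)" "(y, w)"]
      point_prob_Pair_if_entropy_eq[OF sf2(7) sf(1) YZW_det, of "((y, z), w)" x] that
    by (simp_all add: P1 P2 P3 indep)
  have ex_w: "\<exists>w. 0 < point_prob W w" and ex_x: "\<exists>x. 0 < point_prob X x" and ex_y: "\<exists>y. 0 < point_prob Y y"
    and ex_z: "\<exists>z. 0 < point_prob Z z"
    using sf by (simp_all add: ex_point_prob_pos)
  \<comment> \<open>By independence of \<open>Y\<close>, \<open>Z\<close>, \<open>W\<close>, any
    three values of positive mass occur together with positive probability.\<close>
  have ext_x: "\<exists>x. 0 < P x y z w"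
    if "0 < point_prob Y y" "0 < point_prob Z z" "0 < point_prob W w" for y z w
    using point_prob_pos_extend[OF sf2(7) sf(1), of "((y, z), w)"] that
    unfolding P3 by (auto simp: indep)
  have ext_yz: "\<exists>y z. 0 < P x y z w" if "0 < point_prob X x" "0 < point_prob W w" for x w
  proof -
    have "0 < point_prob (\<lambda>\<omega>. (X \<omega>, W \<omega>)) (x, w)" using that by (simp add: indep)
    from point_prob_pos_extend[OF sf2(3) sf2(4) this]
    obtain s where "0 < point_prob (\<lambda>\<omega>. ((X \<omega>, W \<omega>), (Y \<omega>, Z \<omega>))) ((x, w), s)" .
    then show ?thesis by (cases s) (auto simp: P4)
  qed
  \<comment> \<open>At a common outcome the first two factorizations in \<open>eq\<close> share the
    factor \<open>point_prob X x\<close>, which cancels.\<close>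
  have YZ_eq: "point_prob Y y = point_prob Z z" if "0 < point_prob Y y" "0 < point_prob Z z" for y z
  proof -
    obtain w x where "0 < P x y z w" using ex_w ext_x \<open>0 < point_prob Y y\<close> \<open>0 < point_prob Z z\<close> by blast
    with eq(1,2)[OF this] show ?thesis by auto
  qed
  obtain c where Yc: "\<And>y. 0 < point_prob Y y \<Longrightarrow> point_prob Y y = c"
    and Zc: "\<And>z. 0 < point_prob Z z \<Longrightarrow> point_prob Z z = c"
  proof -
    obtain y0 z0 where "0 < point_prob Y y0" "0 < point_prob Z z0"
      using ex_y ex_z by blast
    with YZ_eq that[of "point_prob Z z0"] show ?thesis by metis
  qed
  obtain k :: nat where k: "0 < k" "c = 1 / real k" "\<H>(Y) = log b (real k)"
    using entropy_if_point_prob_const[OF sf(2) Yc] by blast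
  have P_pos: "0 < point_prob X x \<and> 0 < point_prob Y y \<and> 0 < point_prob Z z \<and> 0 < point_prob W w"
    if "0 < P x y z w" for x y z w
    using that eq[OF that] by (auto simp: zero_less_mult_iff zero_less_measure_iff)
  \<comment> \<open>The first and third factorizations share the factor
    \<open>point_prob Y y\<close>; the remaining weight of \<open>z\<close> is
    \<open>c\<close>.\<close>
  have XW_eq: "point_prob X x = c * point_prob W w" if "0 < point_prob X x" "0 < point_prob W w" for x w
  proof -
    obtain y z where yz: "0 < P x y z w" using ext_yz \<open>0 < point_prob X x\<close> \<open>0 < point_prob W w\<close> by blast
    then have "point_prob X x * point_prob Y y = c * point_prob W w * point_prob Y y"
      using P_pos[OF yz] eq(1,3)[OF yz] Zc[of z] by simp
    then show ?thesis using P_pos[OF yz] by simp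
  qed
  obtain x where x: "0 < point_prob X x" using ex_x by blast
  \<comment> \<open>With \<open>x\<close> fixed, the weight of \<open>w\<close> no longer depends on
    \<open>w\<close>, so \<open>W\<close> is uniform.\<close>
  have Wd: "point_prob W w = point_prob X x / c" if "0 < point_prob W w" for w
    using XW_eq[OF x that] k by simp
  obtain m :: nat where m: "0 < m" "point_prob X x / c = 1 / real m" "\<H>(W) = log b (real m)"
    using entropy_if_point_prob_const[OF sf(4) Wd] by blast
  obtain w where w: "0 < point_prob W w" using ex_w by blast
  \<comment> \<open>These pairs complete the fixed \<open>(x, w)\<close> to an outcome of positive
    mass. Each carries mass \<open>point_prob X x * c\<close>, so independence of \<open>X\<close>
    and \<open>W\<close> turns the count into
    \<open>point_prob W w = real (card S) * c\<close>.\<close>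
  define S where "S = {s \<in> (\<lambda>\<omega>. (Y \<omega>, Z \<omega>)) ` space M. 0 < P x (fst s) (snd s) w}"
  have "point_prob X x * point_prob W w = point_prob (\<lambda>\<omega>. (X \<omega>, W \<omega>)) (x, w)"
    by (simp add: indep)
  also have "\<dots> = (\<Sum>s\<in>(\<lambda>\<omega>. (Y \<omega>, Z \<omega>)) ` space M. P x (fst s) (snd s) w)"
    unfolding point_prob_marginal[OF sf2(3) sf2(4)]
    by (intro sum.cong refl) (simp add: P4[symmetric])
  also have "\<dots> = (\<Sum>s\<in>S. P x (fst s) (snd s) w)"
    unfolding S_def using simple_functionD(1)[OF sf2(4)]
    by (intro sum.mono_neutral_right) (auto simp: P_def zero_less_measure_iff)
  also have "\<dots> = (\<Sum>s\<in>S. point_prob X x * c)"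
    by (intro sum.cong refl) (use eq(1) P_pos Yc in \<open>fastforce simp: S_def\<close>)
  finally have "point_prob W w = real (card S) * c"
    using x by simp
  then have kn: "k = m * card S"
  proof -
    have "1 / real m = real (card S) / real k"
      using \<open>point_prob W w = real (card S) * c\<close> Wd[OF w] m(2) k(2) by simp
    then have "real k = real (m * card S)"
      using m(1) k(1) by (simp add: field_simps)
    then show ?thesis by (simp only: of_nat_eq_iff)
  qed
  with k have "0 < card S" by (cases "card S") auto
  with that[OF m(1) this m(3)] k(3) kn m(1) show ?thesis
    by (simp add: log_mult)
qed

section \<open>Entropy bounds for the construction\<close>

lemma (in information_space) entropy_pair_le:
  assumes "simple_function M X" "simple_function M Y"
  shows "\<H>(\<lambda>\<omega>. (X \<omega>, Y \<omega>)) \<le> \<H>(X) + \<H>(Y)"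
  using entropy_chain_rule[OF assms] conditional_entropy_less_eq_entropy[OF assms(2,1)] by simp

lemma (in information_space) entropy_le_log_card:
  assumes X: "simple_function M X" and "X ` space M \<subseteq> C" "finite C"
  shows "\<H>(X) \<le> log b (real (card C))"
proof -
  have "\<H>(X) \<le> log b (real (card (X ` space M)))"
    by (rule entropy_le_card[OF simple_distributedI[OF X measure_nonneg refl]])
  also have "\<dots> \<le> log b (real (card C))"
  proof -
    have "0 < card (X ` space M)" "card (X ` space M) \<le> card C"
      using assms not_empty by (auto simp: card_gt_0_iff card_mono simple_functionD)
    with b_gt_1 show ?thesis by simp
  qed
  finally show ?thesis .
qed

text \<open>Each fibre of \<open>X\<close> is a single point, so \<open>X\<close> is uniform on
  \<open>card A\<close> values.\<close>

lemma entropy_uniform_count_measure_inj: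
  assumes fin: "finite A" and "A \<noteq> {}" and inj: "inj_on X A" and "1 < b"
  shows "prob_space.entropy (uniform_count_measure A) b (count_space (X ` A)) X = log b (real (card A))"
proof -
  let ?M = "uniform_count_measure A"
  interpret information_space ?M b
    using assms prob_space_uniform_count_measure
    by (simp add: information_space_def information_space_axioms_def)
  have "simple_distributed ?M X (\<lambda>_. 1 / real (card A))"
  proof (rule simple_distributedI)
    show "simple_function ?M X"
      using fin by (auto simp: simple_function_def space_uniform_count_measure sets_uniform_count_measure)
    fix x assume "x \<in> X ` space ?M"
    then obtain a where "a \<in> A" "x = X a" by (auto simp: space_uniform_count_measure)
    then have "X -` {x} \<inter> space ?M = {a}"
      using inj by (auto simp: space_uniform_count_measure inj_on_def)
    then show "1 / real (card A) = measure ?M (X -` {x} \<inter> space ?M)"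
      using fin \<open>a \<in> A\<close> by (simp add: measure_uniform_count_measure)
  qed simp
  from entropy_simple_distributed[OF this] show ?thesis
    using assms by (simp add: space_uniform_count_measure card_image log_divide card_gt_0_iff)
qed

lemma entropy_function_mono:
  assumes M: "prob_space M" and X: "\<And>i. simple_function M (X i)" and "A \<subseteq> B"
  shows "entropy_function M X $ A \<le> entropy_function M X $ B"
proof -
  interpret information_space M 2
    using M by (simp add: information_space_def information_space_axioms_def)
  have sf: "simple_function M (subvector X D)" for D
    by (rule simple_function_subvector[OF X])
  have eq: "(\<lambda>g. restrict g A) \<circ> subvector X B = subvector X A"
    using \<open>A \<subseteq> B\<close> by (auto simp: subvector_def fun_eq_iff)
  show ?thesis
    using entropy_data_processing[OF sf, of "\<lambda>g. restrict g A" B]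
    unfolding eq by (simp add: entropy_function_def)
qed

lemma entropy_function_Un_le:
  assumes M: "prob_space M" and X: "\<And>i. simple_function M (X i)"
  shows "entropy_function M X $ (A \<union> B) \<le> entropy_function M X $ A + entropy_function M X $ B"
proof -
  interpret information_space M 2
    using M by (simp add: information_space_def information_space_axioms_def)
  have sf: "simple_function M (subvector X D)" for D
    by (rule simple_function_subvector[OF X])
  \<comment> \<open>Gluing the two subvectors recovers the one on the union, so it is a function of
    the pair; on the overlap both agree.\<close>
  let ?f = "\<lambda>(g, g'). restrict (\<lambda>i. if i \<in> A then g i else g' i) (A \<union> B)"
  have eq: "?f \<circ> (\<lambda>\<omega>. (subvector X A \<omega>, subvector X B \<omega>)) = subvector X (A \<union> B)"
    by (auto simp: subvector_def fun_eq_iff)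
  show ?thesis
    using entropy_data_processing[OF simple_function_Pair[OF sf[of A] sf[of B]], of ?f]
      entropy_pair_le[OF sf[of A] sf[of B]]
    unfolding eq by (simp add: entropy_function_def)
qed

lemma entropy_function_singleton_le:
  assumes M: "prob_space M" and X: "\<And>i. simple_function M (X i)"
    and "X i ` space M \<subseteq> C" "finite C"
  shows "entropy_function M X $ {i} \<le> log 2 (real (card C))"
proof -
  interpret information_space M 2
    using M by (simp add: information_space_def information_space_axioms_def)
  have "entropy_function M X $ {i} = entropy_Pow (X i)"
    by (rule entropy_function_eqI[OF M X]) simp
  with entropy_le_log_card[OF X assms(3,4)] show ?thesis by simp
qed

text \<open>For summands below \<open>n\<close>, reduction subtracts \<open>n\<close> at most once.
  Hence a modular sum together with one summand determines the other.\<close>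

lemma add_mod_eq_cancel:
  fixes a b c d n :: nat
  assumes "(a + b) mod n = (c + d) mod n" "a < n" "b < n" "c < n" "d < n"
  shows "a = c \<longleftrightarrow> b = d"
proof -
  have "(x + y) mod n = (if x + y < n then x + y else x + y - n)" if "x < n" "y < n" for x y
    using that by (simp add: le_mod_geq)
  then show ?thesis
    using assms by (auto split: if_splits)
qed

section \<open>Realization by modular sums\<close>

text \<open>Most marginal distributions need no computation: range sizes bound the singletons from
  above, injectivity gives the large sets their full entropy, and monotonicity and subadditivity
  squeeze the rest to the values of the face point.\<close>

lemma entropic_face_point_log_nat:
  fixes v w :: nat
  assumes "0 < v" "0 < w"
  shows "entropic (face_point U_hat_3_5_1 U_2_3_123 (log 2 (real v)) (log 2 (real w)))"
proof -
  define \<Omega> where "\<Omega> = {..<v} \<times> {..<v} \<times> {..<v} \<times> {..<w} \<times> {..<w}"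
  define X :: "4 \<Rightarrow> nat \<times> nat \<times> nat \<times> nat \<times> nat \<Rightarrow> nat \<times> nat \<times> nat"
    \<comment> \<open>The entries 0 are padding that gives all four variables the same type.\<close>
    where "X = (\<lambda>i (p, q, r, s, t).
      if i = 1 then ((p + q) mod v, (q + r) mod v, (s + t) mod w)
      else if i = 2 then (p, s, 0) else if i = 3 then (q, t, 0) else (r, 0, 0))"
  define M where "M = uniform_count_measure \<Omega>"
  define h where "h = entropy_function M X"
  define a b where "a = log 2 (real v)" and "b = log 2 (real w)"
  have fin: "finite \<Omega>" and ne: "\<Omega> \<noteq> {}"
    using assms by (auto simp: \<Omega>_def)
  have sp: "space M = \<Omega>" by (simp add: M_def space_uniform_count_measure)
  have M: "prob_space M" unfolding M_def by (rule prob_space_uniform_count_measure[OF fin ne])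
  then interpret information_space M 2
    by (simp add: information_space_def information_space_axioms_def)
  have sf: "simple_function M f" for f :: "_ \<Rightarrow> 'x"
    using fin by (auto simp: simple_function_def M_def space_uniform_count_measure sets_uniform_count_measure)
  have X_simps: "X 1 (p, q, r, s, t) = ((p + q) mod v, (q + r) mod v, (s + t) mod w)"
    "X 2 (p, q, r, s, t) = (p, s, 0)" "X 3 (p, q, r, s, t) = (q, t, 0)"
    "X 4 (p, q, r, s, t) = (r, 0, 0)" for p q r s t
    by (simp_all add: X_def)
  have total: "log 2 (real (card \<Omega>)) = 3 * a + 2 * b"
    using assms by (simp add: \<Omega>_def a_def b_def log_mult card_cartesian_product)
  have H_inj: "entropy_Pow Y = 3 * a + 2 * b" if "inj_on Y \<Omega>" for Y :: "_ \<Rightarrow> 'x"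
    using entropy_uniform_count_measure_inj[OF fin ne that, of 2] by (simp add: total sp flip: M_def)
  have sub_eq: "X i x = X i y" if "subvector X A x = subvector X A y" "i \<in> A" for A i x y
    using fun_cong[OF that(1), of i] that(2) by (simp add: subvector_def)
  have h_inj: "h $ A = 3 * a + 2 * b"
    if "\<And>x y. x \<in> \<Omega> \<Longrightarrow> y \<in> \<Omega> \<Longrightarrow> \<forall>i\<in>A. X i x = X i y \<Longrightarrow> x = y" for A
  proof -
    have "inj_on (subvector X A) \<Omega>"
      by (rule inj_onI) (use that sub_eq in blast)
    from H_inj[OF this] show ?thesis by (simp add: h_def entropy_function_def)
  qed
  \<comment> \<open>Once \<open>X 1\<close> is fixed, agreement in one of \<open>p\<close>,
    \<open>q\<close>, \<open>r\<close> forces agreement in all three, and likewise for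
    \<open>s\<close> and \<open>t\<close>. So \<open>X 2\<close> or \<open>X 3\<close> pins down the
    outcome, while \<open>X 4\<close> leaves only the pair of \<open>s\<close> and \<open>t\<close>
    open.\<close>
  have X1_eq: "(p = p' \<longleftrightarrow> q = q') \<and> (q = q' \<longleftrightarrow> r = r') \<and> (s = s' \<longleftrightarrow> t = t')"
    if "(p, q, r, s, t) \<in> \<Omega>" "(p', q', r', s', t') \<in> \<Omega>"
      "X 1 (p, q, r, s, t) = X 1 (p', q', r', s', t')" for p q r s t p' q' r' s' t'
    using that add_mod_eq_cancel[of p q v p' q'] add_mod_eq_cancel[of q r v q' r']
      add_mod_eq_cancel[of s t w s' t']
    unfolding X_simps \<Omega>_def by simp
  have "h $ {1, 2} = 3 * a + 2 * b"
  proof (rule h_inj)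
    fix x y assume "x \<in> \<Omega>" "y \<in> \<Omega>" "\<forall>i\<in>{1, 2}. X i x = X i y"
    then show "x = y" by (cases x, cases y) (use X1_eq in \<open>force simp: X_simps(2)\<close>)
  qed
  moreover have "h $ {1, 3} = 3 * a + 2 * b"
  proof (rule h_inj)
    fix x y assume "x \<in> \<Omega>" "y \<in> \<Omega>" "\<forall>i\<in>{1, 3}. X i x = X i y"
    then show "x = y" by (cases x, cases y) (use X1_eq in \<open>force simp: X_simps(3)\<close>)
  qed
  moreover have "h $ {2, 3, 4} = 3 * a + 2 * b"
  proof (rule h_inj)
    fix x y assume "x \<in> \<Omega>" "y \<in> \<Omega>" "\<forall>i\<in>{2, 3, 4}. X i x = X i y"
    then show "x = y" by (cases x, cases y) (simp add: X_simps(2-4))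
  qed
  moreover have "h $ {1, 2, 3, 4} = 3 * a + 2 * b"
  proof (rule h_inj)
    fix x y assume "x \<in> \<Omega>" "y \<in> \<Omega>" "\<forall>i\<in>{1, 2, 3, 4}. X i x = X i y"
    then show "x = y" by (cases x, cases y) (simp add: X_simps(2-4))
  qed
  moreover have "h $ {} = 0"
  proof -
    have "subvector X {} ` space M \<subseteq> {\<lambda>_. undefined}"
      by (auto simp: subvector_def)
    from entropy_le_log_card[OF sf this] have "h $ {} \<le> 0"
      by (simp add: h_def entropy_function_def)
    \<comment> \<open>This reads \<open>h $ {} \<le> 2 * h $ {}\<close>, which gives
      nonnegativity.\<close>
    moreover have "h $ ({} \<union> {}) \<le> h $ {} + h $ {}"
      unfolding h_def by (rule entropy_function_Un_le[OF M sf])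
    ultimately show ?thesis by simp
  qed
  moreover have "h $ {1} \<le> 2 * a + b"
  proof -
    have "X 1 ` space M \<subseteq> {..<v} \<times> {..<v} \<times> {..<w}"
      using assms by (auto simp: sp \<Omega>_def X_simps)
    from entropy_function_singleton_le[where X=X, OF M sf this] show ?thesis
      using assms by (simp add: h_def a_def b_def log_mult card_cartesian_product)
  qed
  moreover have "h $ {2} \<le> a + b"
  proof -
    have "X 2 ` space M \<subseteq> {..<v} \<times> {..<w} \<times> {0}"
      using assms by (auto simp: sp \<Omega>_def X_simps)
    from entropy_function_singleton_le[where X=X, OF M sf this] show ?thesis
      using assms by (simp add: h_def a_def b_def log_mult card_cartesian_product)
  qed
  moreover have "h $ {3} \<le> a + b"
  proof -
    have "X 3 ` space M \<subseteq> {..<v} \<times> {..<w} \<times> {0}"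
      using assms by (auto simp: sp \<Omega>_def X_simps)
    from entropy_function_singleton_le[where X=X, OF M sf this] show ?thesis
      using assms by (simp add: h_def a_def b_def log_mult card_cartesian_product)
  qed
  moreover have "h $ {4} \<le> a"
  proof -
    have "X 4 ` space M \<subseteq> {..<v} \<times> {0} \<times> {0}"
      using assms by (auto simp: sp \<Omega>_def X_simps)
    from entropy_function_singleton_le[where X=X, OF M sf this] show ?thesis
      using assms by (simp add: h_def a_def b_def log_mult card_cartesian_product)
  qed
  moreover have "3 * a + 2 * b \<le> h $ {1, 4} + b"
  proof -
    \<comment> \<open>Adjoining \<open>s\<close>, which has entropy at most \<open>b\<close>, to \<open>(X\<^sub>1, X\<^sub>4)\<close> recovers the whole outcome.\<close>
    let ?U = "\<lambda>(p :: nat, q :: nat, r :: nat, s :: nat, t :: nat). s"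
    have "inj_on (\<lambda>x. (subvector X {1, 4} x, ?U x)) \<Omega>"
    proof (rule inj_onI)
      fix x y assume "x \<in> \<Omega>" "y \<in> \<Omega>" and eq: "(subvector X {1, 4} x, ?U x) = (subvector X {1, 4} y, ?U y)"
      moreover have "X 1 x = X 1 y" "X 4 x = X 4 y"
        using eq by (auto intro: sub_eq)
      ultimately show "x = y"
        by (cases x, cases y) (use X1_eq in \<open>force simp: X_simps(4)\<close>)
    qed
    then have "3 * a + 2 * b \<le> entropy_Pow (subvector X {1, 4}) + entropy_Pow ?U"
      using H_inj[of "\<lambda>x. (subvector X {1, 4} x, ?U x)"]
        entropy_pair_le[OF sf sf, of "subvector X {1, 4}" ?U] by linarith
    moreover have "?U ` space M \<subseteq> {..<w}"
      by (auto simp: sp \<Omega>_def)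
    from entropy_le_log_card[OF sf this] have "entropy_Pow ?U \<le> b"
      by (simp add: b_def)
    ultimately show ?thesis
      by (simp add: h_def entropy_function_def)
  qed
  moreover have "h $ {1, 2} \<le> h $ {1, 2, 3}" "h $ {1, 2, 3} \<le> h $ {1, 2, 3, 4}"
    "h $ {1, 2} \<le> h $ {1, 2, 4}" "h $ {1, 2, 4} \<le> h $ {1, 2, 3, 4}"
    "h $ {1, 3} \<le> h $ {1, 3, 4}" "h $ {1, 3, 4} \<le> h $ {1, 2, 3, 4}"
    unfolding h_def by (rule entropy_function_mono[OF M sf]; blast)+
  moreover have "h $ {1, 2} \<le> h $ {1} + h $ {2}" "h $ {1, 3} \<le> h $ {1} + h $ {3}"
    "h $ {1, 4} \<le> h $ {1} + h $ {4}" "h $ {2, 3} \<le> h $ {2} + h $ {3}"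
    "h $ {2, 4} \<le> h $ {2} + h $ {4}" "h $ {3, 4} \<le> h $ {3} + h $ {4}"
    "h $ {2, 3, 4} \<le> h $ {2} + h $ {3, 4}" "h $ {2, 3, 4} \<le> h $ {2, 3} + h $ {4}"
    "h $ {2, 3, 4} \<le> h $ {2, 4} + h $ {3}"
    unfolding h_def
    by (rule order_trans[OF eq_refl entropy_function_Un_le[where X=X, OF M sf]],
        rule arg_cong[where f="($) _"], blast)+
  \<comment> \<open>For example, \<open>3 * a + 2 * b = h $ {1, 2} \<le> h $ {1} + h $ {2} \<le> 3 *
    a + 2 * b\<close> fixes both singletons; the pairs inside \<open>{2, 3, 4}\<close> get their
    lower bounds by removing the third element.\<close>
  ultimately have "face_point U_hat_3_5_1 U_2_3_123 a b = h"
    by (simp only: vec_eq_iff all_4_set ranks_values face_point_nth) (intro conjI; linarith)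
  then show ?thesis
    unfolding a_def b_def h_def using entropicI[OF M sf] by metis
qed

section \<open>Both directions for points of the face\<close>

lemma entropic_face_point_imp_log_nat:
  fixes a b :: real
  assumes "entropic (face_point U_hat_3_5_1 U_2_3_123 a b)"
  shows "\<exists>v w :: nat. 0 < v \<and> 0 < w \<and> a = log 2 (real v) \<and> b = log 2 (real w)"
proof -
  obtain M :: "(4 \<Rightarrow> nat) measure" and X :: "4 \<Rightarrow> (4 \<Rightarrow> nat) \<Rightarrow> nat" where M: "prob_space M"
    and X: "\<And>i. simple_function M (X i)"
    and h: "face_point U_hat_3_5_1 U_2_3_123 a b = entropy_function M X"
    using assms unfolding entropic_def by auto
  interpret information_space M 2
    using M by (simp add: information_space_def information_space_axioms_def)
  \<comment> \<open>Any tuple with the level sets of the coordinates in \<open>A\<close> has the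
    entropy prescribed by the face point, however it is bracketed.\<close>
  have val: "entropy_Pow Y = a * U_hat_3_5_1 $ A + b * U_2_3_123 $ A"
    if "\<And>\<omega> \<omega>'. Y \<omega> = Y \<omega>' \<longleftrightarrow> (\<forall>i\<in>A. X i \<omega> = X i \<omega>')" for A and Y :: "_ \<Rightarrow> 'x"
    using entropy_function_eqI[where X=X, OF M X that] by (simp flip: h)
  have H: "entropy_Pow (X 1) = 2 * a + b"
    "entropy_Pow (X 2) = a + b"
    "entropy_Pow (X 3) = a + b"
    "entropy_Pow (X 4) = a"
    "entropy_Pow (\<lambda>\<omega>. (X 1 \<omega>, X 2 \<omega>)) = 3 * a + 2 * b"
    "entropy_Pow (\<lambda>\<omega>. (X 1 \<omega>, X 3 \<omega>)) = 3 * a + 2 * b"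
    "entropy_Pow (\<lambda>\<omega>. (X 1 \<omega>, X 4 \<omega>)) = 3 * a + b"
    "entropy_Pow (\<lambda>\<omega>. (X 2 \<omega>, X 3 \<omega>)) = 2 * a + 2 * b"
    "entropy_Pow (\<lambda>\<omega>. ((X 2 \<omega>, X 3 \<omega>), X 4 \<omega>)) = 3 * a + 2 * b"
    "entropy_Pow (\<lambda>\<omega>. ((X 1 \<omega>, X 2 \<omega>), (X 3 \<omega>, X 4 \<omega>))) = 3 * a + 2 * b"
    using val[of "X 1" "{1}"]
      val[of "X 2" "{2}"]
      val[of "X 3" "{3}"]
      val[of "X 4" "{4}"]
      val[of "\<lambda>\<omega>. (X 1 \<omega>, X 2 \<omega>)" "{1, 2}"]
      val[of "\<lambda>\<omega>. (X 1 \<omega>, X 3 \<omega>)" "{1, 3}"]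
      val[of "\<lambda>\<omega>. (X 1 \<omega>, X 4 \<omega>)" "{1, 4}"]
      val[of "\<lambda>\<omega>. (X 2 \<omega>, X 3 \<omega>)" "{2, 3}"]
      val[of "\<lambda>\<omega>. ((X 2 \<omega>, X 3 \<omega>), X 4 \<omega>)" "{2, 3, 4}"]
      val[of "\<lambda>\<omega>. ((X 1 \<omega>, X 2 \<omega>), (X 3 \<omega>, X 4 \<omega>))" "{1, 2, 3, 4}"]
    by (auto simp: ranks_values)
  \<comment> \<open>Two further bracketings of all four coordinates, as needed for the determination
    hypotheses of \<open>tight_entropies_eq_log_nat\<close>.\<close>
  have H': "entropy_Pow (\<lambda>\<omega>. ((X 1 \<omega>, X 3 \<omega>), (X 2 \<omega>, X 4 \<omega>))) = 3 * a + 2 * b"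
    "entropy_Pow (\<lambda>\<omega>. (((X 2 \<omega>, X 3 \<omega>), X 4 \<omega>), X 1 \<omega>)) = 3 * a + 2 * b"
    by (rule trans[OF val[of _ "{1, 2, 3, 4}"]]; auto simp: ranks_values)+
  obtain m n :: nat where "0 < m" "0 < n" "entropy_Pow (X 4) = log 2 (real m)"
    "entropy_Pow (X 2) = log 2 (real m) + log 2 (real n)"
    by (rule tight_entropies_eq_log_nat[OF X[of 1] X[of 2] X[of 3] X[of 4]]) (simp_all add: H H')
  \<comment> \<open>Here \<open>a\<close> is the entropy of \<open>X 4\<close> and
    \<open>a + b\<close> that of \<open>X 2\<close>, so \<open>m\<close> and \<open>n\<close> are
    the required integers.\<close>
  then show ?thesis using H by force
qed

theorem mainTheorem19:
  fixes a b :: real and h :: set_function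
  assumes "0 \<le> a" and "0 \<le> b"
    and "h \<in> spanned_face U_hat_3_5_1 U_2_3_123"
    and "h = face_point U_hat_3_5_1 U_2_3_123 a b"
  shows "entropic h \<longleftrightarrow>
    (\<exists>v1 v2 :: nat. 0 < v1 \<and> 0 < v2 \<and> a = log 2 (real v1) \<and> b = log 2 (real v2))"
  using entropic_face_point_imp_log_nat[of a b] entropic_face_point_log_nat assms(4) by auto

end
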